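(* Assume that the helper has a large buffer ($Q\ge L$) and that the helper's CPU is underutilized ($\ell<U_K$). Then the energy-efficient offloading policy, i.e. the solution of $$\min_{\boldsymbol{\ell}\ge\boldsymbol 0}\ \sum_{k=1}^K\frac{\tau_k}{h^2}\,g\!\left(\frac{\ell_k}{\tau_k}\right)\quad\text{s.t.}\quad \sum_{k=1}^K d_k(\ell_k)=\sum_{k=1}^K\ell_k=\ell,\qquad \sum_{j=1}^k\ell_j-\sum_{j=1}^k d_j(\ell_j)\le Q,\ k=1,\dots,K,$$ is given by the shortest path (from $(0,0)$ to $(T_{\rm end},\ell)$) in the effective offloading feasibility tunnel $$\bar{\mathcal T}(\ell)=\Big\{\boldsymbol{\ell}\ :\ [U_k-\Delta(\ell)]^+\le\sum_{j=1}^k\ell_j\le\ell,\ k=1,\dots,K-1,\ \sum_{k=1}^K\ell_k=\ell\Big\},\qquad \Delta(\ell)=U_K-\ell .$$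
   Context: Setting. A user with $L$ bits of input data offloads $\ell$ of them, $0\le\ell\le L$, to a helper. The helper's CPU alternates between idle and busy states; state changes occur at times $0=s_0<s_1<\dots<s_K=T_{\rm end}$, and epoch $k$ is $[s_{k-1},s_k]$ of length $\tau_k=s_k-s_{k-1}$. The indicator $a_k\in\{0,1\}$ equals $1$ if the CPU is idle in epoch $k$ and $0$ if busy; consecutive epochs have different states and the last epoch $K$ is idle. The helper's CPU frequency is $f_h>0$, $C>0$ is the number of CPU cycles needed per bit, and $U_k=\sum_{j=1}^k a_j\tau_j f_h/C$. The helper's buffer has size $Q$ bits. An offloading policy is a vector $\boldsymbol{\ell}=(\ell_1,\dots,\ell_K)\ge\boldsymbol 0$ ($\ell_k$ = bits offloaded in epoch $k$). The computed bits $d_k$ and buffer contents $B_k$ evolve by $B_0=0$, $d_k(\ell_k)=\min\{B_{k-1}+\ell_k,\ a_k\tau_kf_h/C\}$, $B_k=\sum_{j=1}^k\ell_j-\sum_{j=1}^kd_j(\ell_j)$. The energy function is $g(x)=N_0(2^{x/W}-1)$ with constants $h,N_0,W>0$. Notation: $[x]^+=\max\{x,0\}$. The path of a policy is the piecewise-linear curve through the points $(s_k,\sum_{j=1}^k\ell_j)$, $k=0,\dots,K$; its length is $\sum_{k=1}^K\sqrt{\ell_k^2+\tau_k^2}$. The shortest path in a tunnel is the path of minimum length among (nonnegative) policies in it. *)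

theory Defs
  imports "HOL-Analysis.Analysis"
begin

definition duration :: "(nat \<Rightarrow> real) \<Rightarrow> nat \<Rightarrow> real" where
  "duration s k = s k - s (k - 1)"

(* bits that the helper can compute in epoch k: a_k * tau_k * f_h / C *)
definition capacity :: "(nat \<Rightarrow> real) \<Rightarrow> (nat \<Rightarrow> nat) \<Rightarrow> real \<Rightarrow> real \<Rightarrow> nat \<Rightarrow> real" where
  "capacity s a fh C k = real (a k) * duration s k * fh / C"

definition U :: "(nat \<Rightarrow> real) \<Rightarrow> (nat \<Rightarrow> nat) \<Rightarrow> real \<Rightarrow> real \<Rightarrow> nat \<Rightarrow> real" where
  "U s a fh C k = (\<Sum>j=1..k. capacity s a fh C j)"

(* A vector (l_1, ..., l_K) is a function that is undefined outside {1..K}, so that equality of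
   functions is equality of vectors. *)
definition policies :: "nat \<Rightarrow> (nat \<Rightarrow> real) set" where
  "policies K = {1..K} \<rightarrow>\<^sub>E {0..}"

(* c k is the capacity of epoch k. The closed form of the buffer content as offloaded minus computed
   bits is the lemma buffer_eq below. *)
primrec buffer :: "(nat \<Rightarrow> real) \<Rightarrow> (nat \<Rightarrow> real) \<Rightarrow> nat \<Rightarrow> real" where
  "buffer c l 0 = 0"
| "buffer c l (Suc k) = buffer c l k + l (Suc k) - min (buffer c l k + l (Suc k)) (c (Suc k))"

definition computed :: "(nat \<Rightarrow> real) \<Rightarrow> (nat \<Rightarrow> real) \<Rightarrow> nat \<Rightarrow> real" where
  "computed c l k = min (buffer c l (k - 1) + l k) (c k)"

lemma buffer_eq: "buffer c l k = (\<Sum>j=1..k. l j) - (\<Sum>j=1..k. computed c l j)"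
  by (induction k) (simp_all add: computed_def)

definition g :: "real \<Rightarrow> real \<Rightarrow> real \<Rightarrow> real" where
  "g N0 W x = N0 * (2 powr (x / W) - 1)"

definition energy ::
  "nat \<Rightarrow> (nat \<Rightarrow> real) \<Rightarrow> real \<Rightarrow> real \<Rightarrow> real \<Rightarrow> (nat \<Rightarrow> real) \<Rightarrow> real" where
  "energy K s h N0 W l =
     (\<Sum>k=1..K. duration s k / h\<^sup>2 * g N0 W (l k / duration s k))"

definition feasible ::
  "nat \<Rightarrow> (nat \<Rightarrow> real) \<Rightarrow> (nat \<Rightarrow> nat) \<Rightarrow> real \<Rightarrow> real \<Rightarrow> real \<Rightarrow> real \<Rightarrow> (nat \<Rightarrow> real) \<Rightarrow> bool" where
  "feasible K s a fh C Q ell l \<longleftrightarrow>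
     l \<in> policies K \<and>
     (\<Sum>k=1..K. computed (capacity s a fh C) l k) = ell \<and>
     (\<Sum>k=1..K. l k) = ell \<and>
     (\<forall>k\<in>{1..K}. (\<Sum>j=1..k. l j) - (\<Sum>j=1..k. computed (capacity s a fh C) l j) \<le> Q)"

definition energy_efficient ::
  "nat \<Rightarrow> (nat \<Rightarrow> real) \<Rightarrow> (nat \<Rightarrow> nat) \<Rightarrow> real \<Rightarrow> real \<Rightarrow> real \<Rightarrow> real \<Rightarrow> real \<Rightarrow> real \<Rightarrow> real \<Rightarrow>
   (nat \<Rightarrow> real) \<Rightarrow> bool" where
  "energy_efficient K s a fh C Q h N0 W ell l \<longleftrightarrow>
     is_arg_min (energy K s h N0 W) (feasible K s a fh C Q ell) l"

definition effective_tunnel ::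
  "nat \<Rightarrow> (nat \<Rightarrow> real) \<Rightarrow> (nat \<Rightarrow> nat) \<Rightarrow> real \<Rightarrow> real \<Rightarrow> real \<Rightarrow> (nat \<Rightarrow> real) set" where
  "effective_tunnel K s a fh C ell =
     (let \<Delta> = U s a fh C K - ell in
      {l. (\<forall>k\<in>{1..K - 1}. max (U s a fh C k - \<Delta>) 0 \<le> (\<Sum>j=1..k. l j) \<and> (\<Sum>j=1..k. l j) \<le> ell) \<and>
          (\<Sum>k=1..K. l k) = ell})"

(* length of the polygonal curve through the points (s k, \<Sum>j=1..k. l j), k = 0, ..., K *)
definition path_length :: "nat \<Rightarrow> (nat \<Rightarrow> real) \<Rightarrow> (nat \<Rightarrow> real) \<Rightarrow> real" where
  "path_length K s l = (\<Sum>k=1..K. sqrt ((l k)\<^sup>2 + (duration s k)\<^sup>2))"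

definition shortest_path_in ::
  "nat \<Rightarrow> (nat \<Rightarrow> real) \<Rightarrow> (nat \<Rightarrow> real) set \<Rightarrow> (nat \<Rightarrow> real) \<Rightarrow> bool" where
  "shortest_path_in K s T l \<longleftrightarrow>
     is_arg_min (path_length K s) (\<lambda>p. p \<in> policies K \<and> p \<in> T) l"

end

theory Submission
  imports Defs
begin

text \<open>Unrolling the buffer recursion shows that the feasible policies are exactly the nonnegative
  policies in the tunnel. There the constraints are lower bounds \<open>b k\<close> on the partial sums, and the
  taut string \<open>S\<close> above \<open>b\<close> has nonincreasing slopes, which change only where \<open>S\<close> touches \<open>b\<close>. By
  Abel summation these two properties make it the strict minimizer of
  \<open>\<Sum>k. \<tau> k * \<psi> (l k / \<tau> k)\<close> for \<^emph>\<open>every\<close> strictly convex \<open>\<psi>\<close>; energy and path length are the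
  cases \<open>\<psi> = g / h\<^sup>2\<close> and \<open>\<psi> x = sqrt (1 + x\<^sup>2)\<close>.\<close>

section \<open>Strict convexity through supporting lines\<close>

text \<open>Strict convexity on the whole line, with a chosen slope \<psi>' of a supporting line at
  every point. In this form no derivatives are needed.\<close>

definition strict_subgradient :: "(real \<Rightarrow> real) \<Rightarrow> (real \<Rightarrow> real) \<Rightarrow> bool" where
  "strict_subgradient \<psi> \<psi>' \<longleftrightarrow> (\<forall>x y. y \<noteq> x \<longrightarrow> \<psi> x + \<psi>' x * (y - x) < \<psi> y)"

lemma strict_subgradient_less:
  "strict_subgradient \<psi> \<psi>' \<Longrightarrow> y \<noteq> x \<Longrightarrow> \<psi> x + \<psi>' x * (y - x) < \<psi> y"
  by (auto simp: strict_subgradient_def)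

text \<open>The supporting inequalities at the two points add up to the claim.\<close>

lemma strict_subgradient_mono:
  assumes "strict_subgradient \<psi> \<psi>'" "x \<le> y"
  shows "\<psi>' x \<le> \<psi>' y"
proof (cases "x = y")
  case False
  have "\<psi> x + \<psi>' x * (y - x) < \<psi> y" "\<psi> y + \<psi>' y * (x - y) < \<psi> x"
    using assms(1) False by (auto intro: strict_subgradient_less)
  then have "\<psi>' x * (y - x) < \<psi>' y * (y - x)"
    by (simp add: algebra_simps)
  then show ?thesis
    using assms(2) False by simp
qed simp

text \<open>In the perspective \<open>\<tau> * \<psi> (l / \<tau>)\<close> the outer factor cancels
  the inner one, so the subgradient in \<open>l\<close> depends only on the slope
  \<open>l / \<tau>\<close>.\<close>

lemma strict_subgradient_perspective:
  assumes "strict_subgradient \<psi> \<psi>'" "\<tau> > 0" "m \<noteq> l"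
  shows "\<tau> * \<psi> (l / \<tau>) + \<psi>' (l / \<tau>) * (m - l) < \<tau> * \<psi> (m / \<tau>)"
proof -
  have "\<psi> (l / \<tau>) + \<psi>' (l / \<tau>) * (m / \<tau> - l / \<tau>) < \<psi> (m / \<tau>)"
    using assms by (intro strict_subgradient_less) auto
  then have "\<tau> * (\<psi> (l / \<tau>) + \<psi>' (l / \<tau>) * (m / \<tau> - l / \<tau>)) < \<tau> * \<psi> (m / \<tau>)"
    using assms(2) by simp
  moreover have "\<tau> * (\<psi>' (l / \<tau>) * (m / \<tau> - l / \<tau>)) = \<psi>' (l / \<tau>) * (m - l)"
    using assms(2) by (simp add: right_diff_distrib)
  ultimately show ?thesis
    by (simp add: distrib_left)
qed

text \<open>Squaring the weak inequality at \<open>x / 2\<close> gains \<open>x\<^sup>2 / 4\<close>,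
  which makes it strict.\<close>

lemma exp_gt_add_one:
  fixes x :: real
  assumes "x \<noteq> 0"
  shows "1 + x < exp x"
proof -
  have "1 + x / 2 \<le> exp (x / 2)" by (rule exp_ge_add_one_self)
  show ?thesis
  proof (cases "1 + x / 2 \<ge> 0")
    case True
    have "1 + x < (1 + x / 2)\<^sup>2"
      using assms by (auto simp: power2_eq_square algebra_simps zero_less_mult_iff)
    also have "\<dots> \<le> (exp (x / 2))\<^sup>2"
      using True \<open>1 + x / 2 \<le> exp (x / 2)\<close> by (intro power_mono)
    also have "\<dots> = exp x"
      by (simp add: power2_eq_square flip: exp_add)
    finally show ?thesis .
  next
    case False
    then have "1 + x < 0" by simp
    then show ?thesis using exp_gt_zero[of x] by linarith
  qed
qed

lemma strict_subgradient_g: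
  assumes "N0 > 0" "W > 0" "h > 0"
  shows "strict_subgradient (\<lambda>x. g N0 W x / h\<^sup>2) (\<lambda>x. N0 * (2 powr (x / W) * (ln 2 / W)) / h\<^sup>2)"
  unfolding strict_subgradient_def
proof (intro allI impI)
  fix x y :: real
  assume "y \<noteq> x"
  \<comment> \<open>The change of the exponent in base e; the claim becomes
    \<open>1 + u < exp u\<close>, scaled by a positive factor.\<close>
  define u where "u = (y - x) / W * ln 2"
  have "u \<noteq> 0" using \<open>y \<noteq> x\<close> assms by (simp add: u_def)
  have "2 powr (y / W) = 2 powr (x / W) * exp u"
    using assms by (simp add: powr_def u_def field_simps flip: exp_add)
  moreover have "2 powr (x / W) * (1 + u) < 2 powr (x / W) * exp u"
    using exp_gt_add_one[OF \<open>u \<noteq> 0\<close>] by simp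
  ultimately have "N0 / h\<^sup>2 * (2 powr (x / W) * (1 + u)) < N0 / h\<^sup>2 * 2 powr (y / W)"
    using assms by (intro mult_strict_left_mono) auto
  then show "g N0 W x / h\<^sup>2 + N0 * (2 powr (x / W) * (ln 2 / W)) / h\<^sup>2 * (y - x) < g N0 W y / h\<^sup>2"
    unfolding g_def u_def by (simp add: algebra_simps add_divide_distrib diff_divide_distrib)
qed

lemma strict_subgradient_sqrt:
  "strict_subgradient (\<lambda>x. sqrt (1 + x\<^sup>2)) (\<lambda>x. x / sqrt (1 + x\<^sup>2))"
  unfolding strict_subgradient_def
proof (intro allI impI)
  fix x y :: real
  assume "y \<noteq> x"
  define r where "r = sqrt (1 + x\<^sup>2)"
  have r: "r > 0" "r\<^sup>2 = 1 + x\<^sup>2"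
    by (auto simp: r_def add_pos_nonneg)
  \<comment> \<open>Strict Cauchy-Schwarz for the vectors (1, x) and (1, y); the gap is
    \<open>(x - y)\<^sup>2\<close>.\<close>
  have "(1 + x * y)\<^sup>2 < (1 + x\<^sup>2) * (1 + y\<^sup>2)"
  proof -
    have "(x - y)\<^sup>2 > 0" using \<open>y \<noteq> x\<close> by simp
    then show ?thesis by (simp add: power2_eq_square algebra_simps)
  qed
  then have "1 + x * y < sqrt ((1 + x\<^sup>2) * (1 + y\<^sup>2))"
    by (rule real_less_rsqrt)
  then have "1 + x * y < r * sqrt (1 + y\<^sup>2)"
    by (simp add: r_def real_sqrt_mult)
  then have "(r\<^sup>2 + x * (y - x)) / r < sqrt (1 + y\<^sup>2)"
    using r by (simp add: pos_divide_less_eq algebra_simps power2_eq_square)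
  then have "r + x / r * (y - x) < sqrt (1 + y\<^sup>2)"
    using r(1) by (simp add: add_divide_distrib power2_eq_square)
  then show "sqrt (1 + x\<^sup>2) + x / sqrt (1 + x\<^sup>2) * (y - x) < sqrt (1 + y\<^sup>2)"
    by (simp add: r_def)
qed

section \<open>Existence of the taut string\<close>

text \<open>\<open>S\<close> is the string and \<open>x\<close> its slopes. The last conjunct, a bound on the first slope, is
  what lets two strings be glued at a touching point.\<close>

definition taut_string ::
  "nat \<Rightarrow> nat \<Rightarrow> (nat \<Rightarrow> real) \<Rightarrow> (nat \<Rightarrow> real) \<Rightarrow> (nat \<Rightarrow> real) \<Rightarrow> (nat \<Rightarrow> real) \<Rightarrow> bool" where
  "taut_string n K s b S x \<longleftrightarrow> S n = b n \<and> S K = b K \<and> (\<forall>k\<in>{n..K}. b k \<le> S k) \<and>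
    (\<forall>k\<in>{n<..K}. S k - S (k - 1) = x k * (s k - s (k - 1))) \<and>
    (\<forall>k\<in>{n<..K}. 0 \<le> x k) \<and>
    (\<forall>k\<in>{n<..<K}. x (Suc k) \<le> x k \<and> (b k < S k \<longrightarrow> x (Suc k) = x k)) \<and>
    (\<forall>c. n < K \<longrightarrow> (\<forall>j\<in>{n<..K}. b j - b n \<le> c * (s j - s n)) \<longrightarrow> x (Suc n) \<le> c)"

text \<open>The string leaves \<open>n\<close> along the steepest chord of \<open>b\<close>.\<close>

lemma taut_string_exists:
  fixes s b :: "nat \<Rightarrow> real"
  assumes "n \<le> K" "\<And>i j. n \<le> i \<Longrightarrow> i < j \<Longrightarrow> j \<le> K \<Longrightarrow> s i < s j"
    and "\<And>k. n \<le> k \<Longrightarrow> k \<le> K \<Longrightarrow> b k \<le> b K"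
  shows "\<exists>S x. taut_string n K s b S x"
  using assms
proof (induction "K - n" arbitrary: n rule: less_induct)
  case less
  show ?case
  proof (cases "n = K")
    case True
    then show ?thesis by (intro exI[of _ b]) (simp add: taut_string_def)
  next
    case False
    then have "n < K" using less.prems(1) by simp
    define r where "r k = (b k - b n) / (s k - s n)" for k
    obtain m where m: "m \<in> {n<..K}" and max: "\<And>k. k \<in> {n<..K} \<Longrightarrow> r k \<le> r m"
    proof -
      have "Max (r ` {n<..K}) \<in> r ` {n<..K}"
        using \<open>n < K\<close> by (intro Max_in) auto
      then obtain m where "m \<in> {n<..K}" "r m = Max (r ` {n<..K})" by auto
      then show ?thesis by (intro that[of m]) auto
    qed
    have pos: "s n < s k" if "k \<in> {n<..K}" for k
      using less.prems(2) that by auto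
    have below: "b k \<le> b n + r m * (s k - s n)" if "k \<in> {n..K}" for k
    proof (cases "k = n")
      case False
      then have k: "k \<in> {n<..K}" using that by auto
      show ?thesis using max[OF k] pos[OF k] by (simp add: r_def[of k] pos_divide_le_eq)
    qed simp
    have chord: "b m = b n + r m * (s m - s n)"
      using pos[OF m] by (simp add: r_def)
    \<comment> \<open>The chord to \<open>K\<close> does not descend because \<open>b K\<close> is
      the largest value of \<open>b\<close>; the steepest chord is at least as steep.\<close>
    have "0 \<le> r K"
      using pos[of K] less.prems(3)[of n] \<open>n < K\<close> by (simp add: r_def)
    then have r0: "0 \<le> r m"
      using max[of K] \<open>n < K\<close> by simp
    have "K - m < K - n" "m \<le> K" using m by auto
    then obtain S x where "taut_string m K s b S x"
      using less.hyps[of m] less.prems m by auto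
    then have S: "S m = b m" "S K = b K" "\<And>k. k \<in> {m..K} \<Longrightarrow> b k \<le> S k"
      and inc: "\<And>k. k \<in> {m<..K} \<Longrightarrow> S k - S (k - 1) = x k * (s k - s (k - 1))"
      and x0: "\<And>k. k \<in> {m<..K} \<Longrightarrow> 0 \<le> x k"
      and anti: "\<And>k. k \<in> {m<..<K} \<Longrightarrow> x (Suc k) \<le> x k \<and> (b k < S k \<longrightarrow> x (Suc k) = x k)"
      and first: "\<And>c. m < K \<Longrightarrow> (\<And>j. j \<in> {m<..K} \<Longrightarrow> b j - b m \<le> c * (s j - s m)) \<Longrightarrow> x (Suc m) \<le> c"
      unfolding taut_string_def by blast+
    \<comment> \<open>The line of slope \<open>r m\<close> from \<open>n\<close> stays above
      \<open>b\<close> and passes through the point at \<open>m\<close>, so \<open>r m\<close> is an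
      admissible \<open>c\<close> for the remaining string.\<close>
    have glue: "x (Suc m) \<le> r m" if "m < K"
    proof (rule first[OF that])
      fix j assume "j \<in> {m<..K}"
      then have "b j \<le> b n + r m * (s j - s n)" using m by (intro below) auto
      then show "b j - b m \<le> r m * (s j - s m)" using chord by (simp add: algebra_simps)
    qed
    define S' where "S' k = (if k \<le> m then b n + r m * (s k - s n) else S k)" for k
    define x' where "x' k = (if k \<le> m then r m else x k)" for k
    \<comment> \<open>The chord and the remaining string agree at \<open>m\<close>, so the increment
      of epoch \<open>Suc m\<close> can be read off \<open>S\<close> alone.\<close>
    have at_m: "S' k = S k" if "m \<le> k" for k
      using that S(1) chord by (auto simp: S'_def)
    have "taut_string n K s b S' x'"
      unfolding taut_string_def
    proof (intro conjI ballI allI impI)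
      show "S' n = b n" using m by (simp add: S'_def)
      show "S' K = b K" using at_m S m by simp
    next
      fix k assume "k \<in> {n..K}"
      then show "b k \<le> S' k"
        using below[of k] S(3)[of k] by (auto simp: S'_def)
    next
      fix k assume k: "k \<in> {n<..K}"
      show "S' k - S' (k - 1) = x' k * (s k - s (k - 1))"
      proof (cases "k \<le> m")
        case True
        then have "k - 1 \<le> m" by simp
        with True show ?thesis by (simp only: S'_def x'_def if_True) (simp add: algebra_simps)
      next
        case False
        then show ?thesis using k inc[of k] at_m[of k] at_m[of "k - 1"] by (simp add: x'_def)
      qed
      show "0 \<le> x' k" using r0 x0 k by (simp add: x'_def)
    next
      fix k assume k: "k \<in> {n<..<K}"
      show "x' (Suc k) \<le> x' k"
        using k anti[of k] glue by (cases k m rule: linorder_cases) (auto simp: x'_def)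
      \<comment> \<open>The slope may drop at \<open>k = m\<close>, but there \<open>S'\<close>
        touches \<open>b\<close>, which contradicts this assumption.\<close>
      assume "b k < S' k"
      then show "x' (Suc k) = x' k"
        using k anti[of k] at_m[of k] S(1) by (cases k m rule: linorder_cases) (auto simp: x'_def)
    next
      \<comment> \<open>The instance \<open>j = m\<close> of the assumption already gives
        \<open>r m \<le> c\<close>.\<close>
      fix c assume "\<forall>j\<in>{n<..K}. b j - b n \<le> c * (s j - s n)"
      then show "x' (Suc n) \<le> c"
        using m pos[OF m] by (auto simp: x'_def r_def pos_divide_le_eq)
    qed
    then show ?thesis by blast
  qed
qed

section \<open>Optimality of the taut string\<close>

text \<open>Rewrites a first-order change in terms of partial sums, the quantities that the tunnel
  constrains.\<close>

lemma Abel_summation: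
  fixes D e :: "nat \<Rightarrow> 'a::comm_ring"
  shows "(\<Sum>k=1..K. D k * e k) =
    (\<Sum>k=1..<K. (D k - D (Suc k)) * (\<Sum>j=1..k. e j)) + D K * (\<Sum>j=1..K. e j)"
proof (induction K)
  case (Suc K)
  then show ?case
    by (cases K) (simp_all add: algebra_simps)
qed simp

lemma taut_string_minimizes:
  fixes l m \<tau> b :: "nat \<Rightarrow> real"
  assumes "strict_subgradient \<psi> \<psi>'"
    and pos: "\<And>k. k \<in> {1..K} \<Longrightarrow> \<tau> k > 0"
    and anti: "\<And>k. k \<in> {1..<K} \<Longrightarrow> l (Suc k) / \<tau> (Suc k) \<le> l k / \<tau> k"
    and taut: "\<And>k. k \<in> {1..<K} \<Longrightarrow> b k < (\<Sum>j=1..k. l j) \<Longrightarrow> l (Suc k) / \<tau> (Suc k) = l k / \<tau> k"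
    and l: "\<And>k. k \<in> {1..<K} \<Longrightarrow> b k \<le> (\<Sum>j=1..k. l j)"
    and m: "\<And>k. k \<in> {1..<K} \<Longrightarrow> b k \<le> (\<Sum>j=1..k. m j)"
    and total: "(\<Sum>j=1..K. m j) = (\<Sum>j=1..K. l j)"
    and diff: "i \<in> {1..K}" "m i \<noteq> l i"
  shows "(\<Sum>k=1..K. \<tau> k * \<psi> (l k / \<tau> k)) < (\<Sum>k=1..K. \<tau> k * \<psi> (m k / \<tau> k))"
proof -
  define D where "D k = \<psi>' (l k / \<tau> k)" for k
  \<comment> \<open>Complementary slackness: \<open>D k - D (Suc k)\<close> is the multiplier of the
    \<open>k\<close>-th lower bound. It vanishes where \<open>l\<close> is off the bound; at a
    contact it is nonnegative and \<open>m\<close> cannot lie below \<open>l\<close>.\<close>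
  have "0 \<le> (D k - D (Suc k)) * (\<Sum>j=1..k. m j - l j)" if k: "k \<in> {1..<K}" for k
  proof (cases "b k < (\<Sum>j=1..k. l j)")
    case True
    then show ?thesis using taut[OF k] by (simp add: D_def)
  next
    case False
    then have "0 \<le> (\<Sum>j=1..k. m j - l j)"
      using l[OF k] m[OF k] by (simp add: sum_subtractf)
    moreover have "D (Suc k) \<le> D k"
      unfolding D_def by (rule strict_subgradient_mono[OF assms(1) anti[OF k]])
    ultimately show ?thesis by simp
  qed
  then have "0 \<le> (\<Sum>k=1..<K. (D k - D (Suc k)) * (\<Sum>j=1..k. m j - l j))"
    by (rule sum_nonneg)
  \<comment> \<open>The boundary term of the Abel summation vanishes because the totals
    agree.\<close>
  also have "\<dots> = (\<Sum>k=1..K. D k * (m k - l k))"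
    using total Abel_summation[of D "\<lambda>k. m k - l k" K] by (simp add: sum_subtractf)
  finally have "(\<Sum>k=1..K. \<tau> k * \<psi> (l k / \<tau> k)) \<le> (\<Sum>k=1..K. \<tau> k * \<psi> (l k / \<tau> k) + D k * (m k - l k))"
    by (simp add: sum.distrib)
  also have "\<dots> < (\<Sum>k=1..K. \<tau> k * \<psi> (m k / \<tau> k))"
  proof (rule sum_strict_mono_ex1)
    have less: "\<tau> k * \<psi> (l k / \<tau> k) + D k * (m k - l k) < \<tau> k * \<psi> (m k / \<tau> k)"
      if "k \<in> {1..K}" "m k \<noteq> l k" for k
      unfolding D_def using assms(1) pos[OF that(1)] that(2) by (rule strict_subgradient_perspective)
    show "\<forall>k\<in>{1..K}. \<tau> k * \<psi> (l k / \<tau> k) + D k * (m k - l k) \<le> \<tau> k * \<psi> (m k / \<tau> k)"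
    proof
      fix k assume "k \<in> {1..K}"
      then show "\<tau> k * \<psi> (l k / \<tau> k) + D k * (m k - l k) \<le> \<tau> k * \<psi> (m k / \<tau> k)"
        using less[of k] by (cases "m k = l k") auto
    qed
    show "\<exists>k\<in>{1..K}. \<tau> k * \<psi> (l k / \<tau> k) + D k * (m k - l k) < \<tau> k * \<psi> (m k / \<tau> k)"
      using less diff by blast
  qed simp
  finally show ?thesis .
qed

text \<open>\<psi> is quantified after \<open>l\<close> is obtained, so a single policy serves both
  energy and length.\<close>

lemma taut_string_policy:
  assumes "\<And>k. k \<in> {1..K} \<Longrightarrow> duration s k > 0"
    and "b 0 = 0" "\<And>k. k \<le> K \<Longrightarrow> b k \<le> b K"
  obtains l where "l \<in> policies K" "(\<Sum>k=1..K. l k) = b K"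
    "\<forall>k\<le>K. b k \<le> (\<Sum>j=1..k. l j)"
    "\<forall>\<psi> \<psi>' m. strict_subgradient \<psi> \<psi>' \<and> m \<in> policies K \<and> (\<Sum>k=1..K. m k) = b K \<and>
       (\<forall>k\<in>{1..<K}. b k \<le> (\<Sum>j=1..k. m j)) \<and> m \<noteq> l \<longrightarrow>
       (\<Sum>k=1..K. duration s k * \<psi> (l k / duration s k)) <
       (\<Sum>k=1..K. duration s k * \<psi> (m k / duration s k))"
proof -
  have "s i < s j" if "i < j" "j \<le> K" for i j
    using that
  proof (induction j)
    case (Suc j)
    have "s j < s (Suc j)" using assms(1)[of "Suc j"] Suc.prems by (simp add: duration_def)
    then show ?case using Suc by (cases "i = j") auto
  qed simp
  then obtain S x where "taut_string 0 K s b S x"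
    using taut_string_exists[of 0 K s b] assms(3) by auto
  then have S: "S 0 = b 0" "S K = b K" "\<And>k. k \<le> K \<Longrightarrow> b k \<le> S k"
    and inc: "\<And>k. k \<in> {1..K} \<Longrightarrow> S k - S (k - 1) = x k * duration s k"
    and x0: "\<And>k. k \<in> {1..K} \<Longrightarrow> 0 \<le> x k"
    and anti: "\<And>k. k \<in> {1..<K} \<Longrightarrow> x (Suc k) \<le> x k"
    and taut: "\<And>k. k \<in> {1..<K} \<Longrightarrow> b k < S k \<Longrightarrow> x (Suc k) = x k"
    by (simp_all add: taut_string_def duration_def)
  \<comment> \<open>The restriction makes \<open>l\<close> undefined outside \<open>{1..K}\<close>,
    as membership in \<open>policies K\<close> requires.\<close>
  define l where "l = (\<lambda>k\<in>{1..K}. x k * duration s k)"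
  have slope: "l k / duration s k = x k" if "k \<in> {1..K}" for k
    using that assms(1)[OF that] by (simp add: l_def)
  have sum_l: "(\<Sum>j=1..k. l j) = S k" if "k \<le> K" for k
    using that
  proof (induction k)
    case (Suc k)
    then show ?case using inc[of "Suc k"] by (simp add: l_def)
  qed (simp add: S assms(2))
  have l_pol: "l \<in> policies K"
    unfolding policies_def l_def
    using x0 assms(1) by (intro restrict_PiE_iff[THEN iffD2]) (auto simp: less_imp_le)
  show thesis
  proof (rule that[OF l_pol])
    show "(\<Sum>k=1..K. l k) = b K" using sum_l S by simp
    show "\<forall>k\<le>K. b k \<le> (\<Sum>j=1..k. l j)" using sum_l S(3) by simp
  next
    have "(\<Sum>k=1..K. duration s k * \<psi> (l k / duration s k)) <
       (\<Sum>k=1..K. duration s k * \<psi> (m k / duration s k))"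
      if \<psi>: "strict_subgradient \<psi> \<psi>'" and m: "m \<in> policies K" "(\<Sum>k=1..K. m k) = b K"
        "\<And>k. k \<in> {1..<K} \<Longrightarrow> b k \<le> (\<Sum>j=1..k. m j)" "m \<noteq> l" for \<psi> \<psi>' m
    proof -
      \<comment> \<open>Both vectors are undefined outside \<open>{1..K}\<close>, so they must
        differ at an index inside.\<close>
      obtain i where i: "i \<in> {1..K}" "m i \<noteq> l i"
        using PiE_ext[OF m(1)[unfolded policies_def] l_pol[unfolded policies_def]] m(4) by blast
      show ?thesis
        using \<psi> assms(1) _ _ _ m(3) _ i
        by (rule taut_string_minimizes) (use slope anti taut sum_l S m(2) in auto)
    qed
    then show "\<forall>\<psi> \<psi>' m. strict_subgradient \<psi> \<psi>' \<and> m \<in> policies K \<and> (\<Sum>k=1..K. m k) = b K \<and>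
       (\<forall>k\<in>{1..<K}. b k \<le> (\<Sum>j=1..k. m j)) \<and> m \<noteq> l \<longrightarrow>
       (\<Sum>k=1..K. duration s k * \<psi> (l k / duration s k)) <
       (\<Sum>k=1..K. duration s k * \<psi> (m k / duration s k))"
      by blast
  qed
qed

section \<open>Feasible policies and the tunnel\<close>

text \<open>The recursion is the Lindley recursion
  \<open>max 0 (buffer c l k + l (Suc k) - c (Suc k))\<close>. Hence the buffer is the maximum over
  \<open>j\<close> of the net inflow after epoch \<open>j\<close>, stated here through its upper
  bounds.\<close>

lemma buffer_le_iff:
  "buffer c l k \<le> x \<longleftrightarrow> (\<forall>j\<le>k. (\<Sum>i=1..k. l i - c i) - (\<Sum>i=1..j. l i - c i) \<le> x)"
proof (induction k arbitrary: x)
  case (Suc k)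
  have "buffer c l (Suc k) \<le> x \<longleftrightarrow> 0 \<le> x \<and> buffer c l k \<le> x - (l (Suc k) - c (Suc k))"
    by (simp add: min_def) linarith
  also have "\<dots> \<longleftrightarrow> 0 \<le> x \<and> (\<forall>j\<le>k. (\<Sum>i=1..k. l i - c i) - (\<Sum>i=1..j. l i - c i) \<le> x - (l (Suc k) - c (Suc k)))"
    unfolding Suc.IH ..
  also have "\<dots> \<longleftrightarrow> (\<forall>j\<le>Suc k. (\<Sum>i=1..Suc k. l i - c i) - (\<Sum>i=1..j. l i - c i) \<le> x)"
    by (auto simp: le_Suc_eq algebra_simps)
  finally show ?case .
qed simp

lemma buffer_nonneg: "0 \<le> buffer c l k"
  by (cases k) auto

text \<open>Given nonnegativity and the total, the upper boundary, the positive part and the buffer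
  limit (as \<open>ell \<le> Q\<close>) are automatic. What remains is that the buffer is empty at
  the end.\<close>

lemma feasible_iff_tunnel:
  assumes cap: "\<And>k. k \<in> {1..K} \<Longrightarrow> 0 \<le> capacity s a fh C k"
    and "K \<ge> 1" "ell \<le> Q" "ell \<le> U s a fh C K"
  shows "feasible K s a fh C Q ell l \<longleftrightarrow> l \<in> policies K \<and> l \<in> effective_tunnel K s a fh C ell"
proof (cases "l \<in> policies K \<and> (\<Sum>k=1..K. l k) = ell")
  case True
  let ?c = "capacity s a fh C"
  let ?u = "U s a fh C"
  have l0: "0 \<le> l k" if "k \<in> {1..K}" for k
    using True that by (auto simp: policies_def PiE_iff)
  have S0: "0 \<le> (\<Sum>j=1..k. l j)" if "k \<le> K" for k
    using that by (intro sum_nonneg l0) auto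
  have S_le: "(\<Sum>j=1..k. l j) \<le> ell" if "k \<le> K" for k
  proof -
    have "(\<Sum>j=1..k. l j) \<le> (\<Sum>j=1..K. l j)"
      using that l0 by (intro sum_mono2) auto
    then show ?thesis using True by simp
  qed
  have Q: "(\<Sum>j=1..k. l j) - (\<Sum>j=1..k. computed ?c l j) \<le> Q" if "k \<in> {1..K}" for k
  proof -
    have "0 \<le> (\<Sum>j=1..k. computed ?c l j)"
      using that l0 cap by (intro sum_nonneg) (auto simp: computed_def intro: buffer_nonneg add_nonneg_nonneg)
    then show ?thesis using S_le[of k] that assms(3) by simp
  qed
  have "feasible K s a fh C Q ell l \<longleftrightarrow> buffer ?c l K \<le> 0"
    using True Q buffer_nonneg[of ?c l K] by (auto simp: feasible_def buffer_eq)
  \<comment> \<open>\<open>buffer_le_iff\<close> at \<open>x = 0\<close>, with the total replaced by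
    \<open>ell\<close> and the terms rearranged.\<close>
  also have "\<dots> \<longleftrightarrow> (\<forall>k\<le>K. ?u k - (?u K - ell) \<le> (\<Sum>j=1..k. l j))"
    using True by (auto simp: buffer_le_iff sum_subtractf U_def algebra_simps)
  also have "\<dots> \<longleftrightarrow> (\<forall>k\<in>{1..K - 1}. ?u k - (?u K - ell) \<le> (\<Sum>j=1..k. l j))"
  proof
    assume *: "\<forall>k\<in>{1..K - 1}. ?u k - (?u K - ell) \<le> (\<Sum>j=1..k. l j)"
    show "\<forall>k\<le>K. ?u k - (?u K - ell) \<le> (\<Sum>j=1..k. l j)"
    proof (intro allI impI)
      fix k assume "k \<le> K"
      \<comment> \<open>The two extra indices cost nothing: \<open>k = 0\<close> reads
        \<open>ell \<le> U s a fh C K\<close>, and \<open>k = K\<close> is the equality of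
        totals.\<close>
      then consider "k = 0" | "k = K" | "k \<in> {1..K - 1}" by fastforce
      then show "?u k - (?u K - ell) \<le> (\<Sum>j=1..k. l j)"
        using * True assms(4) by cases (auto simp: U_def)
    qed
  qed auto
  also have "\<dots> \<longleftrightarrow> l \<in> policies K \<and> l \<in> effective_tunnel K s a fh C ell"
    using True S0 S_le by (auto simp: effective_tunnel_def Let_def)
  finally show ?thesis .
qed (auto simp: feasible_def effective_tunnel_def Let_def)

section \<open>Energy and length have the same minimizer\<close>

lemma energy_eq:
  "energy K s h N0 W l = (\<Sum>k=1..K. duration s k * (g N0 W (l k / duration s k) / h\<^sup>2))"
  by (simp add: energy_def)

lemma path_length_eq:
  assumes "\<And>k. k \<in> {1..K} \<Longrightarrow> duration s k > 0"
  shows "path_length K s l = (\<Sum>k=1..K. duration s k * sqrt (1 + (l k / duration s k)\<^sup>2))"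
  unfolding path_length_def
proof (rule sum.cong)
  fix k assume "k \<in> {1..K}"
  then have *: "duration s k > 0" by (rule assms)
  then have "(l k)\<^sup>2 + (duration s k)\<^sup>2 = (duration s k)\<^sup>2 * (1 + (l k / duration s k)\<^sup>2)"
    by (simp add: field_simps)
  then show "sqrt ((l k)\<^sup>2 + (duration s k)\<^sup>2) = duration s k * sqrt (1 + (l k / duration s k)\<^sup>2)"
    using * by (simp add: real_sqrt_mult)
qed simp

lemma is_arg_min_strict:
  fixes f :: "'a \<Rightarrow> 'b::linorder"
  assumes "P z" "\<And>y. P y \<Longrightarrow> y \<noteq> z \<Longrightarrow> f z < f y"
  shows "is_arg_min f P x \<longleftrightarrow> x = z"
  using assms unfolding is_arg_min_def by (metis less_asym)

theorem proposition2:
  fixes K :: nat and s :: "nat \<Rightarrow> real" and a :: "nat \<Rightarrow> nat"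
    and T_end fh C Q L ell h N0 W :: real
  assumes "K \<ge> 1"
    and "s 0 = 0" and "\<forall>k\<in>{1..K}. s (k - 1) < s k" and "s K = T_end"
    and "\<forall>k\<in>{1..K}. a k \<in> {0, 1}"
    and "\<forall>k\<in>{1..<K}. a (Suc k) \<noteq> a k"
    and "a K = 1"
    and "fh > 0" and "C > 0"
    and "h > 0" and "N0 > 0" and "W > 0"
    and "0 \<le> ell" and "ell \<le> L"
    and "Q \<ge> L"
    and "ell < U s a fh C K"
  shows "(\<exists>!l. energy_efficient K s a fh C Q h N0 W ell l) \<and>
         (\<forall>l. energy_efficient K s a fh C Q h N0 W ell l \<longleftrightarrow>
              shortest_path_in K s (effective_tunnel K s a fh C ell) l)"
proof -
  have dur: "duration s k > 0" if "k \<in> {1..K}" for k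
    using assms(3) that by (simp add: duration_def)
  have cap: "0 \<le> capacity s a fh C k" if "k \<in> {1..K}" for k
    using dur[OF that] assms(8,9) by (simp add: capacity_def)
  define P where "P l \<longleftrightarrow> l \<in> policies K \<and> l \<in> effective_tunnel K s a fh C ell" for l
  have feas: "feasible K s a fh C Q ell = P"
    using feasible_iff_tunnel[OF cap assms(1), where ell = ell and Q = Q] assms(14-16)
    by (auto simp: P_def fun_eq_iff)
  \<comment> \<open>The lower boundary of the tunnel, continued to \<open>k = 0\<close> and
    \<open>k = K\<close>, where it takes the end values 0 and \<open>ell\<close> of the
    path.\<close>
  define b where "b k = max (U s a fh C k - (U s a fh C K - ell)) 0" for k
  have b: "b 0 = 0" "b K = ell"
    using assms(13,16) by (auto simp: b_def U_def)
  have b_le: "b k \<le> b K" if "k \<le> K" for k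
  proof -
    have "U s a fh C k \<le> U s a fh C K"
      unfolding U_def using that cap by (intro sum_mono2) auto
    then show ?thesis by (auto simp: b_def)
  qed
  obtain z where z: "z \<in> policies K" "(\<Sum>k=1..K. z k) = b K"
    "\<forall>k\<le>K. b k \<le> (\<Sum>j=1..k. z j)"
    and best: "\<forall>\<psi> \<psi>' m. strict_subgradient \<psi> \<psi>' \<and> m \<in> policies K \<and> (\<Sum>k=1..K. m k) = b K \<and>
       (\<forall>k\<in>{1..<K}. b k \<le> (\<Sum>j=1..k. m j)) \<and> m \<noteq> z \<longrightarrow>
       (\<Sum>k=1..K. duration s k * \<psi> (z k / duration s k)) <
       (\<Sum>k=1..K. duration s k * \<psi> (m k / duration s k))"
    by (rule taut_string_policy[of K s b, OF dur b(1) b_le])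
  have "(\<Sum>j=1..k. z j) \<le> ell" if "k \<le> K" for k
  proof -
    have "(\<Sum>j=1..k. z j) \<le> (\<Sum>j=1..K. z j)"
      using that z(1) by (intro sum_mono2) (auto simp: policies_def PiE_iff)
    then show ?thesis using z(2) b by simp
  qed
  then have Pz: "P z"
    using z b by (auto simp: P_def effective_tunnel_def Let_def b_def)
  have less: "(\<Sum>k=1..K. duration s k * \<psi> (z k / duration s k)) <
       (\<Sum>k=1..K. duration s k * \<psi> (m k / duration s k))"
    if "strict_subgradient \<psi> \<psi>'" "P m" "m \<noteq> z" for \<psi> \<psi>' m
  proof -
    have "m \<in> policies K" "(\<Sum>k=1..K. m k) = b K" "\<forall>k\<in>{1..<K}. b k \<le> (\<Sum>j=1..k. m j)"
      using that(2) b(2) by (auto simp: P_def effective_tunnel_def Let_def b_def)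
    with that best show ?thesis by blast
  qed
  have len: "path_length K s l = (\<Sum>k=1..K. duration s k * sqrt (1 + (l k / duration s k)\<^sup>2))" for l
    using dur by (rule path_length_eq)
  \<comment> \<open>Each of the two problems has \<open>z\<close> as its only solution, so they are
    equivalent.\<close>
  have "energy_efficient K s a fh C Q h N0 W ell l \<longleftrightarrow> l = z" for l
    unfolding energy_efficient_def feas
  proof (rule is_arg_min_strict[of P, OF Pz])
    fix y assume "P y" "y \<noteq> z"
    then show "energy K s h N0 W z < energy K s h N0 W y"
      unfolding energy_eq by (rule less[OF strict_subgradient_g[OF assms(11,12,10)]])
  qed
  moreover have "shortest_path_in K s (effective_tunnel K s a fh C ell) l \<longleftrightarrow> l = z" for l
    unfolding shortest_path_in_def P_def[symmetric]
  proof (rule is_arg_min_strict[of P, OF Pz])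
    fix y assume "P y" "y \<noteq> z"
    then show "path_length K s z < path_length K s y"
      unfolding len by (rule less[OF strict_subgradient_sqrt])
  qed
  ultimately show ?thesis by simp
qed

end
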